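(* Let $\zeta$ be a Pisot number with Pisot polynomial $P_{\zeta}$, and let $q$ be a prime with $q\mid P_{\zeta}(0)$. Let $m\geq1$ be the multiplicity of $0$ as a root of the reduction $P_{\zeta,q}$ of $P_{\zeta}$ modulo $q$ over $\mathbb{Z}_{q}$. Then for every integer $l\geq1$, the element $\zeta^{-lm}\in\mathbb{Z}[\zeta,\zeta^{-1}]$ has denominator divisible by $q^{l}$ in reduced form. In particular, for every positive integer $l$ there exist elements of $\mathbb{Z}[\zeta,\zeta^{-1}]\subset\mathscr{M}_{\zeta}$ whose reduced form has denominator $q^{l}$.
   Context: A Pisot number is a real algebraic integer $\zeta>1$ all of whose conjugates other than $\zeta$ lie strictly inside the unit circle of $\mathbb{C}$; its Pisot polynomial $P_{\zeta}$ is its (monic, integer) minimal polynomial, of degree $k$. For real $\zeta>1$, $\mathscr{M}_{\zeta}$ denotes the set of all $\alpha\in\mathbb{R}$ with $\Vert\alpha\zeta^{n}\Vert\to0$ as $n\to\infty$, where $\Vert x\Vert$ is the distance from $x$ to the nearest integer. Every $a\in\mathbb{Q}(\zeta)$ can be written in reduced form $a=(r_{0}+r_{1}\zeta+\cdots+r_{k-1}\zeta^{k-1})/N$ with integers $r_{j},N$, $N\geq1$, and $\gcd(r_{0},\dots,r_{k-1},N)=1$; $N$ is the denominator of $a$ in reduced form. $\mathbb{Z}_{q}$ is the field with $q$ elements. *)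

theory Defs
  imports
    "HOL-Algebra.Polynomial_Divisibility"
    "HOL-Number_Theory.Residues"
    "HOL-Computational_Algebra.Polynomial"
begin

text \<open>Minimal polynomial over the rationals: the monic annihilating polynomial of least degree.\<close>

definition is_minimal_polynomial :: "real \<Rightarrow> rat poly \<Rightarrow> bool" where
  "is_minimal_polynomial x p \<longleftrightarrow>
     Polynomial.lead_coeff p = 1 \<and> poly (map_poly of_rat p) x = 0 \<and>
     (\<forall>r. r \<noteq> 0 \<and> poly (map_poly of_rat r) x = 0 \<longrightarrow> Polynomial.degree p \<le> Polynomial.degree r)"

definition conjugates :: "real \<Rightarrow> complex set" where
  "conjugates x = {z. \<exists>p. is_minimal_polynomial x p \<and> poly (map_poly of_rat p) z = 0}"

definition pisot_number :: "real \<Rightarrow> bool" where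
  "pisot_number \<zeta> \<longleftrightarrow>
     \<zeta> > 1 \<and> algebraic_int \<zeta> \<and> (\<forall>z \<in> conjugates \<zeta> - {complex_of_real \<zeta>}. cmod z < 1)"

definition is_pisot_polynomial :: "real \<Rightarrow> int poly \<Rightarrow> bool" where
  "is_pisot_polynomial \<zeta> P \<longleftrightarrow> is_minimal_polynomial \<zeta> (map_poly rat_of_int P)"

definition dist_nearest_int :: "real \<Rightarrow> real" where
  "dist_nearest_int x = \<bar>x - of_int (round x)\<bar>"

definition scriptM :: "real \<Rightarrow> real set" where
  "scriptM \<zeta> = {\<alpha>. (\<lambda>n. dist_nearest_int (\<alpha> * \<zeta> ^ n)) \<longlonglongrightarrow> 0}"

text \<open>The ring generated by \<open>\<zeta>\<close> and its inverse over the integers, as the set of values at \<open>\<zeta>\<close> of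
  integral Laurent polynomials.\<close>

definition int_laurent_ring :: "real \<Rightarrow> real set" where
  "int_laurent_ring \<zeta> =
     {(\<Sum>i\<in>I. of_int (c i) * \<zeta> powi i) | (I :: int set) (c :: int \<Rightarrow> int). finite I}"

text \<open>The function \<open>r\<close> lists the numerator coefficients; only its values below \<open>degree P\<close> matter.\<close>

definition reduced_form :: "int poly \<Rightarrow> real \<Rightarrow> real \<Rightarrow> (nat \<Rightarrow> int) \<Rightarrow> int \<Rightarrow> bool" where
  "reduced_form P \<zeta> a r N \<longleftrightarrow>
     N \<ge> 1 \<and> Gcd (insert N (r ` {..<Polynomial.degree P})) = 1 \<and>
     a = (\<Sum>j<Polynomial.degree P. of_int (r j) * \<zeta> ^ j) / of_int N"

definition has_denominator :: "int poly \<Rightarrow> real \<Rightarrow> real \<Rightarrow> int \<Rightarrow> bool" where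
  "has_denominator P \<zeta> a N \<longleftrightarrow> (\<exists>r. reduced_form P \<zeta> a r N)"

text \<open>Polynomials in HOL-Algebra are coefficient lists with the leading coefficient first, which
  must be nonzero, hence the reversal and the normalization. The ring \<open>residue_ring q\<close> has
  carrier \<open>{0..q - 1}\<close> and is a field when \<open>q\<close> is prime.\<close>

definition reduce_mod :: "int \<Rightarrow> int poly \<Rightarrow> int list" where
  "reduce_mod q P = ring.normalize (residue_ring q) (map (\<lambda>c. c mod q) (rev (coeffs P)))"

definition zero_multiplicity_mod :: "int \<Rightarrow> int poly \<Rightarrow> nat" where
  "zero_multiplicity_mod q P =
     ring.alg_mult (residue_ring q) (reduce_mod q P) \<zero>\<^bsub>residue_ring q\<^esub>"

text \<open>The denominator in reduced form is unique, so \<open>has_denominator\<close> is a partial function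
  of the number.\<close>

lemma pisot_polynomial_powers_independent:
  assumes P: "is_pisot_polynomial \<zeta> P"
    and zero: "(\<Sum>j<Polynomial.degree P. real_of_int (c j) * \<zeta> ^ j) = 0"
    and "j < Polynomial.degree P"
  shows "c j = 0"
proof (rule ccontr)
  assume cj: "c j \<noteq> 0"
  define k where "k = Polynomial.degree P"
  define f :: "rat poly" where "f = (\<Sum>i<k. Polynomial.monom (of_int (c i)) i)"
  have cf: "poly.coeff f i = (if i < k then of_int (c i) else 0)" for i
    by (simp add: f_def coeff_sum Polynomial.coeff_monom)
  have "f \<noteq> 0"
    using cf[of j] cj assms(3) by (auto simp: k_def)
  have "poly.coeff f (Polynomial.degree f) \<noteq> 0"
    using \<open>f \<noteq> 0\<close> by simp
  hence deg: "Polynomial.degree f < k"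
    unfolding cf by presburger
  have "map_poly of_rat f = (\<Sum>i<k. Polynomial.monom (real_of_int (c i)) i)"
    by (rule poly_eqI) (simp add: coeff_map_poly cf coeff_sum Polynomial.coeff_monom)
  hence "poly (map_poly of_rat f) \<zeta> = 0"
    using zero by (simp add: poly_sum poly_monom k_def)
  hence "Polynomial.degree (map_poly rat_of_int P) \<le> Polynomial.degree f"
    using P \<open>f \<noteq> 0\<close> by (auto simp: is_pisot_polynomial_def is_minimal_polynomial_def)
  moreover have "Polynomial.degree (map_poly rat_of_int P) = k"
    unfolding k_def by (rule degree_map_poly) auto
  ultimately show False
    using deg by simp
qed

lemma has_denominator_unique:
  assumes P: "is_pisot_polynomial \<zeta> P"
    and "has_denominator P \<zeta> a M" "has_denominator P \<zeta> a N"
  shows "M = N"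
proof -
  have dvd: "M dvd N" if r: "reduced_form P \<zeta> a r M" and s: "reduced_form P \<zeta> a s N" for r s M N
  proof -
    let ?k = "Polynomial.degree P"
    have M: "M \<ge> 1" and N: "N \<ge> 1"
      using r s by (auto simp: reduced_form_def)
    have "(\<Sum>j<?k. of_int (r j) * \<zeta> ^ j) / of_int M = (\<Sum>j<?k. of_int (s j) * \<zeta> ^ j) / of_int N"
      using r s by (auto simp: reduced_form_def)
    hence "of_int N * (\<Sum>j<?k. of_int (r j) * \<zeta> ^ j) = of_int M * (\<Sum>j<?k. of_int (s j) * \<zeta> ^ j)"
      using M N by (simp add: field_simps)
    hence lin: "(\<Sum>j<?k. real_of_int (N * r j - M * s j) * \<zeta> ^ j) = 0"
      by (simp add: sum_distrib_left left_diff_distrib sum_subtractf mult.assoc)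
    have eq: "N * r j = M * s j" if "j < ?k" for j
      using pisot_polynomial_powers_independent[OF P lin that] by simp
    have "M dvd N * x" if x: "x \<in> insert M (r ` {..<?k})" for x
    proof (cases "x = M")
      case False
      then obtain j where "j < ?k" "x = r j"
        using x by blast
      thus ?thesis
        using eq[of j] by (metis dvd_triv_left)
    qed simp
    hence "M dvd Gcd ((*) N ` insert M (r ` {..<?k}))"
      by (intro Gcd_greatest) blast
    also have "\<dots> = normalize (N * Gcd (insert M (r ` {..<?k})))"
      by (rule Gcd_mult)
    finally show ?thesis
      using r by (simp add: reduced_form_def)
  qed
  obtain r s where r: "reduced_form P \<zeta> a r M" and s: "reduced_form P \<zeta> a s N"
    using assms(2,3) unfolding has_denominator_def by blast
  have "M \<ge> 1" "N \<ge> 1"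
    using r s by (simp_all add: reduced_form_def)
  thus ?thesis
    using dvd[OF r s] dvd[OF s r] by (simp add: zdvd_antisym_nonneg)
qed

end

theory Submission
  imports Defs "HOL-Computational_Algebra.Computational_Algebra"
begin

text \<open>
  \<^bold>\<open>Denominators.\<close> Splitting \<open>P\<close> at degree \<open>m\<close> gives \<open>P = x\<^sup>m A + q B\<close> with \<open>q\<close> not dividing \<open>A(0)\<close>, so
  \<open>\<zeta>\<^sup>m A(\<zeta>)\<close> lies in \<open>q \<int>[\<zeta>]\<close>. If \<open>\<zeta>\<close> to the power \<open>-lm\<close> equals \<open>R(\<zeta>)/N\<close>, then multiplying
  \<open>N = \<zeta>\<^sup>l\<^sup>m R(\<zeta>)\<close> by \<open>A(\<zeta>)\<^sup>l\<close> yields \<open>N A\<^sup>l = q\<^sup>l C + P S\<close> in \<open>\<int>[x]\<close>. As \<open>P\<close> is monic, common powers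
  of \<open>q\<close> can be cancelled one at a time, and evaluation at \<open>0\<close> shows that \<open>q\<close> keeps dividing the
  remaining cofactor of \<open>N\<close>, up to \<open>q\<^sup>l\<close>. If \<open>N = q\<^sup>l M\<close>, then \<open>M\<close> times the element has
  denominator exactly \<open>q\<^sup>l\<close>.

  \<^bold>\<open>Membership in \<open>scriptM \<zeta>\<close>.\<close> The power sums of the roots of \<open>P\<close> are integers, and all roots
  other than the simple root \<open>\<zeta>\<close> have powers tending to \<open>0\<close>; hence \<open>1\<close> belongs to the set, which is
  closed under integral combinations and under multiplication by powers of \<open>\<zeta>\<close>.
\<close>

section \<open>Multiplicity of the root 0 as a count of vanishing low coefficients\<close>

text \<open>Lists carry the leading coefficient first, so multiplying by \<open>X\<close> to the
  power n appends n zeros. The multiplicity of 0 thus counts trailing zeros, and its maximality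
  makes the preceding entry nonzero.\<close>

lemma (in domain) alg_mult_zero_append:
  assumes p: "p \<in> carrier (poly_ring R)" "p \<noteq> []"
  obtains r where "p = r @ replicate (alg_mult p \<zero>) \<zero>" "r \<noteq> []" "last r \<noteq> \<zero>"
proof -
  note K = carrier_is_subring
  \<comment> \<open>The linear factor x - 0 in the definition of multiplicity is the variable
    itself.\<close>
  have lin: "[\<one>, \<ominus> \<zero>] = X"
    by (simp add: var_def)
  have pow: "[\<one>, \<ominus> \<zero>] [^]\<^bsub>poly_ring R\<^esub> n = monom \<one> n" for n :: nat
    unfolding lin by (rule unitary_monom_eq_var_pow[OF K, symmetric])
  have mult: "monom \<one> n \<otimes>\<^bsub>poly_ring R\<^esub> r = r @ replicate n \<zero>"
    if "polynomial (carrier R) r" "r \<noteq> []" for r n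
    using poly_mult_monom[OF that(1), of \<one> n] poly_mult_one[OF K that(1)] that(2)
    by (simp add: univ_poly_mult)
  obtain r where r: "polynomial (carrier R) r" "p = monom \<one> (alg_mult p \<zero>) \<otimes>\<^bsub>poly_ring R\<^esub> r"
    using alg_multE(1)[OF zero_closed p] unfolding pow pdivides_def factor_def
    by (auto simp: univ_poly_carrier)
  have "r \<noteq> []"
  proof
    assume "r = []"
    moreover have "set (monom \<one> (alg_mult p \<zero>)) \<subseteq> carrier R"
      by (rule monom_in_carrier) simp
    ultimately show False
      using r(2) p(2) by (simp add: univ_poly_mult poly_mult_zero)
  qed
  have pr: "p = r @ replicate (alg_mult p \<zero>) \<zero>"
    using r \<open>r \<noteq> []\<close> mult by metis
  have "last r \<noteq> \<zero>"
  proof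
    \<comment> \<open>One more trailing zero would let the next higher power of \<open>X\<close>
      divide \<open>p\<close>.\<close>
    assume last: "last r = \<zero>"
    define r' where "r' = butlast r"
    have r': "r = r' @ [\<zero>]"
      using \<open>r \<noteq> []\<close> last by (metis append_butlast_last_id r'_def)
    have "hd r \<noteq> \<zero>" "set r \<subseteq> carrier R"
      using r(1) \<open>r \<noteq> []\<close> by (auto simp: polynomial_def)
    hence "r' \<noteq> []" "polynomial (carrier R) r'"
      using r' by (auto simp: polynomial_def)
    moreover have "p = r' @ replicate (Suc (alg_mult p \<zero>)) \<zero>"
      by (subst pr) (simp add: r')
    ultimately have "p = monom \<one> (Suc (alg_mult p \<zero>)) \<otimes>\<^bsub>poly_ring R\<^esub> r'"
      using mult by metis
    hence "([\<one>, \<ominus> \<zero>] [^]\<^bsub>poly_ring R\<^esub> Suc (alg_mult p \<zero>)) pdivides p"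
      unfolding pow pdivides_def factor_def
      using \<open>polynomial (carrier R) r'\<close> by (auto simp: univ_poly_carrier)
    from alg_multE(2)[OF zero_closed p this] show False
      by simp
  qed
  with pr \<open>r \<noteq> []\<close> show ?thesis
    by (rule that)
qed

text \<open>The bridge from the residue field back to the integers: these two divisibility facts are
  all that the denominator argument uses about the multiplicity.\<close>

lemma zero_multiplicity_mod_least_coeff:
  fixes q :: int and P :: "int poly"
  assumes q: "prime q" and monic: "Polynomial.lead_coeff P = 1"
  shows "i < zero_multiplicity_mod q P \<Longrightarrow> q dvd poly.coeff P i"
    and "\<not> q dvd poly.coeff P (zero_multiplicity_mod q P)"
proof -
  let ?R = "residue_ring q" and ?m = "zero_multiplicity_mod q P"
  have q1: "q > 1"
    using q by (simp add: prime_gt_1_int)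
  interpret residues q ?R
    by (rule residues.intro[OF q1])
  have "prime (nat q)"
    using q prime_int_nat_transfer by blast
  hence "residues_prime (nat q)"
    by (rule residues_prime.intro)
  hence "field (residue_ring (int (nat q)))"
    by (rule residues_prime.is_field)
  hence "field ?R"
    using q1 by simp
  then interpret F: field ?R .
  define p where "p = map (\<lambda>c. c mod q) (rev (coeffs P))"
  have P0: "P \<noteq> 0"
    using monic by auto
  hence ne: "p \<noteq> []" by (simp add: p_def)
  \<comment> \<open>Since \<open>P\<close> is monic and q > 1, the leading entry survives reduction,
    so normalization strips nothing.\<close>
  have hd: "hd p = 1"
    using P0 q1 monic by (simp add: p_def hd_map hd_rev last_coeffs_eq_coeff_degree)
  hence red: "reduce_mod q P = p"
    using ne unfolding reduce_mod_def p_def[symmetric] by (cases p) (auto simp: res_zero_eq)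
  have "set p \<subseteq> carrier ?R"
    by (auto simp: p_def)
  hence "p \<in> carrier (univ_poly ?R (carrier ?R))"
    using hd by (auto simp: univ_poly_carrier[symmetric] polynomial_def res_zero_eq)
  from F.alg_mult_zero_append[OF this ne] obtain r where
    r: "p = r @ replicate ?m 0" "r \<noteq> []" "last r \<noteq> 0"
    by (auto simp: zero_multiplicity_mod_def red res_zero_eq)
  have rev: "rev r = last r # rev (butlast r)"
    using r(2) by (metis append_butlast_last_id rev_eq_Cons_iff rev_rev_ident)
  have "map (\<lambda>c. c mod q) (coeffs P) = rev p"
    by (simp add: p_def rev_map)
  also have "\<dots> = replicate ?m 0 @ last r # rev (butlast r)"
    by (subst r(1)) (simp add: rev)
  finally have *: "map (\<lambda>c. c mod q) (coeffs P) = \<dots>" .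
  have nth: "poly.coeff P i mod q = (replicate ?m 0 @ last r # rev (butlast r)) ! i"
    if "i \<le> ?m" for i
  proof -
    have "i < length (coeffs P)"
      using arg_cong[OF *, of length] that by simp
    thus ?thesis
      by (simp flip: * add: coeffs_nth P0 length_coeffs_degree)
  qed
  show "q dvd poly.coeff P i" if "i < ?m"
    using nth[of i] that by (auto simp: nth_append)
  show "\<not> q dvd poly.coeff P ?m"
    using nth[of ?m] r(3) by (auto simp: nth_append)
qed

section \<open>Cancelling prime powers in \<int>[x]\<close>

text \<open>Gauss's lemma: content is multiplicative, and a monic polynomial has content 1.\<close>

lemma monic_const_dvd_multD:
  fixes P S :: "int poly"
  assumes "Polynomial.lead_coeff P = 1" "[:c:] dvd P * S"
  shows "[:c:] dvd S"
proof -
  have "is_unit (content P)"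
    using content_dvd_coeff[of P "Polynomial.degree P"] assms(1) by simp
  hence "content P = 1"
    by (metis is_unit_normalize normalize_content)
  with assms(2) show ?thesis
    by (simp add: const_poly_dvd_iff_dvd_content content_mult)
qed

lemma prime_power_dvd_of_poly_identity:
  fixes A C P S :: "int poly" and q N :: int
  assumes q: "prime q" and monic: "Polynomial.lead_coeff P = 1" and P0: "q dvd poly P 0"
    and A0: "\<not> q dvd poly A 0"
    and eq: "[:N:] * A ^ n = [:q ^ l:] * C + P * S"
  shows "q ^ l dvd N"
proof -
  have "q ^ j dvd N" if "j \<le> l" for j
    using that
  proof (induction j)
    case (Suc j)
    then obtain M where M: "N = q ^ j * M"
      by (auto elim: dvdE)
    \<comment> \<open>Because j < l, a factor q is still left beside \<open>C\<close> after
      cancelling \<open>q ^ j\<close>.\<close>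
    have l: "q ^ l = q ^ j * (q * q ^ (l - Suc j))"
      using Suc.prems by (simp flip: power_Suc power_add)
    let ?U = "[:M:] * A ^ n - [:q * q ^ (l - Suc j):] * C"
    have c: "[:q ^ l:] = [:q ^ j:] * [:q * q ^ (l - Suc j):]" "[:N:] = [:q ^ j:] * [:M:]"
      by (simp_all add: l M)
    have eq': "[:q ^ j:] * ?U = P * S"
      using eq unfolding c by (simp only: algebra_simps)
    hence "[:q ^ j:] dvd P * S"
      by (metis dvd_triv_left)
    hence "[:q ^ j:] dvd S"
      by (rule monic_const_dvd_multD[OF monic])
    then obtain T where "S = [:q ^ j:] * T"
      by (elim dvdE)
    with eq' have "[:q ^ j:] * ?U = [:q ^ j:] * (P * T)"
      by (simp only: mult_ac)
    moreover have "[:q ^ j:] \<noteq> 0"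
      using q by auto
    ultimately have "?U = P * T"
      using mult_left_cancel by blast
    \<comment> \<open>At 0 both the \<open>C\<close> term and \<open>P * T\<close> are divisible by
      q, while \<open>A\<close> takes a value prime to q; so q must divide \<open>M\<close>.\<close>
    hence "poly ?U 0 = poly (P * T) 0"
      by simp
    hence "M * poly A 0 ^ n = q * q ^ (l - Suc j) * poly C 0 + poly P 0 * poly T 0"
      by simp
    also have "q dvd \<dots>"
      using P0 by simp
    finally have "q dvd M"
      using q A0 by (metis prime_dvd_mult_iff prime_dvd_power)
    thus ?case
      by (auto simp: M)
  qed auto
  thus ?thesis by simp
qed

section \<open>Integer polynomials evaluated at \<zeta>, and reduced forms\<close>

lemma map_poly_of_int_add:
  "map_poly of_int (p + r) = (map_poly of_int p + map_poly of_int r :: 'a :: comm_ring_1 poly)"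
  by (intro poly_eqI) (simp add: coeff_map_poly)

lemma map_poly_of_int_mult:
  "map_poly of_int (p * r) = (map_poly of_int p * map_poly of_int r :: 'a :: comm_ring_1 poly)"
  by (induction p) (simp_all add: map_poly_of_int_add map_poly_pCons map_poly_smult)

lemma map_poly_of_int_power:
  "map_poly of_int (p ^ n) = (map_poly of_int p ^ n :: 'a :: comm_ring_1 poly)"
  by (induction n) (simp_all add: map_poly_of_int_mult)

lemma map_poly_of_int_pderiv:
  "map_poly of_int (pderiv p) = (pderiv (map_poly of_int p) :: 'a :: {comm_ring_1,semiring_no_zero_divisors} poly)"
  by (intro poly_eqI) (simp add: coeff_map_poly coeff_pderiv)

lemma poly_of_int_of_real:
  "poly (map_poly of_int p) (of_real x :: 'a :: {comm_ring_1,real_algebra_1}) = of_real (poly (map_poly of_int p) x)"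
  by (induction p) (simp_all add: map_poly_pCons)

lemma poly_eq_sum_lessThan:
  assumes "\<And>i. i \<ge> k \<Longrightarrow> poly.coeff p i = 0"
  shows "poly (map_poly of_int p) (x :: real) = (\<Sum>j<k. of_int (poly.coeff p j) * x ^ j)"
proof -
  have deg: "Polynomial.degree (map_poly real_of_int p) = Polynomial.degree p"
    by (rule degree_map_poly) auto
  have "(\<Sum>j\<le>Polynomial.degree p. real_of_int (poly.coeff p j) * x ^ j) =
    (\<Sum>j<k. of_int (poly.coeff p j) * x ^ j)"
    using assms by (intro sum.mono_neutral_cong)
      (auto simp: coeff_eq_0 not_le not_less)
  thus ?thesis
    by (simp add: poly_altdef deg coeff_map_poly)
qed

context
  fixes \<zeta> :: real and P :: "int poly"
  assumes P: "is_pisot_polynomial \<zeta> P"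
begin

lemma pisot_polynomial_monic: "Polynomial.lead_coeff P = 1"
proof -
  have "Polynomial.degree (map_poly rat_of_int P) = Polynomial.degree P"
    by (rule degree_map_poly) auto
  thus ?thesis
    using P by (simp add: is_pisot_polynomial_def is_minimal_polynomial_def coeff_map_poly)
qed

lemma pisot_polynomial_root: "poly (map_poly of_int P) \<zeta> = 0"
  using P by (simp add: is_pisot_polynomial_def is_minimal_polynomial_def map_poly_map_poly o_def)

text \<open>Pseudo-division scales \<open>F\<close> by a power of the leading coefficient; that
  power is 1 here, so this is true division over the integers.\<close>

lemma pisot_polynomial_division:
  obtains Q R where "F = P * Q + R" "\<And>i. i \<ge> Polynomial.degree P \<Longrightarrow> poly.coeff R i = 0"
proof -
  obtain Q R where QR: "pseudo_divmod F P = (Q, R)"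
    by fastforce
  have "P \<noteq> 0"
    using pisot_polynomial_monic by auto
  from pseudo_divmod[OF this QR] show ?thesis
    by (intro that[of Q R]) (auto simp: pisot_polynomial_monic coeff_eq_0)
qed

text \<open>The remainder modulo \<open>P\<close> also vanishes at \<zeta>, and the powers of
  \<zeta> below the degree are independent, so it is zero.\<close>

lemma pisot_polynomial_dvd:
  assumes "poly (map_poly of_int F) \<zeta> = 0"
  shows "P dvd F"
proof -
  obtain Q R where F: "F = P * Q + R" and R: "\<And>i. i \<ge> Polynomial.degree P \<Longrightarrow> poly.coeff R i = 0"
    using pisot_polynomial_division[of F] by blast
  have "poly (map_poly of_int R) \<zeta> = 0"
    using assms by (simp add: F map_poly_of_int_add map_poly_of_int_mult pisot_polynomial_root)
  hence "poly.coeff R i = 0" if "i < Polynomial.degree P" for i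
    using pisot_polynomial_powers_independent[OF P _ that, of "poly.coeff R"]
      poly_eq_sum_lessThan[of "Polynomial.degree P" R \<zeta>] R by simp
  hence "R = 0"
    using R by (intro poly_eqI) (metis coeff_0 not_le)
  thus ?thesis
    by (simp add: F)
qed

lemma pisot_polynomial_degree_pos: "Polynomial.degree P > 0"
proof (rule ccontr)
  assume "\<not> ?thesis"
  with pisot_polynomial_monic have "P = 1"
    by (auto elim!: degree_eq_zeroE)
  thus False
    using pisot_polynomial_root by simp
qed

text \<open>Otherwise P = x Q with Q(\<zeta>) = 0, so \<open>P\<close> divides \<open>Q\<close> and
  x would be a unit.\<close>

lemma pisot_polynomial_at_0:
  assumes "\<zeta> \<noteq> 0"
  shows "poly P 0 \<noteq> 0"
proof
  assume "poly P 0 = 0"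
  then obtain Q where Q: "P = [:0, 1:] * Q"
    unfolding poly_eq_0_iff_dvd by (auto elim: dvdE)
  have "poly (map_poly of_int Q) \<zeta> = 0"
    using pisot_polynomial_root assms unfolding Q
    by (simp only: map_poly_of_int_mult) (simp add: map_poly_pCons)
  then obtain T where "Q = P * T"
    using pisot_polynomial_dvd by (auto elim: dvdE)
  hence "P * ([:0, 1:] * T) = P * 1"
    using Q by (metis mult.left_commute mult_1_right)
  moreover have "P \<noteq> 0"
    using pisot_polynomial_monic by auto
  ultimately have "[:0, 1:] * T = 1"
    using mult_left_cancel by blast
  hence "poly ([:0, 1:] * T) 0 = poly 1 0"
    by simp
  thus False
    by simp
qed

text \<open>Reduce the numerator modulo \<open>P\<close>, then divide its coefficients and
  \<open>N\<close> by their gcd.\<close>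

lemma has_denominator_exists:
  assumes "N \<noteq> 0"
  obtains M where "has_denominator P \<zeta> (poly (map_poly of_int F) \<zeta> / of_int N) M"
proof -
  obtain Q R where F: "F = P * Q + R" and R: "\<And>i. i \<ge> Polynomial.degree P \<Longrightarrow> poly.coeff R i = 0"
    using pisot_polynomial_division[of F] by blast
  let ?k = "Polynomial.degree P"
  \<comment> \<open>The sign makes the denominator positive after division by \<open>g\<close>.\<close>
  define g where "g = sgn N * Gcd (insert N (poly.coeff R ` {..<?k}))"
  define r where "r = (\<lambda>j. poly.coeff R j div g)"
  define M where "M = N div g"
  have g0: "g \<noteq> 0"
    using assms by (auto simp: g_def sgn_0_0)
  have "is_unit (sgn N)"
    using assms by (simp add: sgn_if)
  hence gdvd: "g dvd x" if "x \<in> insert N (poly.coeff R ` {..<?k})" for x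
    using that unfolding g_def by (metis Gcd_dvd mult_unit_dvd_iff')
  have M: "N = g * M" and r: "j < ?k \<Longrightarrow> poly.coeff R j = g * r j" for j
    using gdvd by (auto simp: M_def r_def)
  have "M \<ge> 1"
  proof -
    have "sgn g = sgn N"
      using assms g0 by (auto simp: g_def sgn_mult)
    hence "g * M * sgn g > 0"
      using assms M by (metis abs_sgn zero_less_abs_iff)
    hence "\<bar>g\<bar> * M > 0"
      by (simp add: abs_sgn mult_ac)
    thus ?thesis
      by (simp add: zero_less_mult_iff)
  qed
  moreover have "Gcd (insert M (r ` {..<?k})) = 1"
  proof -
    have "\<bar>g\<bar> = Gcd (insert N (poly.coeff R ` {..<?k}))"
      using assms by (simp add: g_def abs_mult abs_sgn_eq)
    also have "insert N (poly.coeff R ` {..<?k}) = (*) g ` insert M (r ` {..<?k})"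
      using M r by (auto simp: image_image)
    also have "Gcd \<dots> = \<bar>g * Gcd (insert M (r ` {..<?k}))\<bar>"
      by (subst Gcd_mult) simp
    finally have "\<bar>g\<bar> * Gcd (insert M (r ` {..<?k})) = \<bar>g\<bar> * 1"
      by (simp add: abs_mult)
    thus ?thesis
      using g0 by (subst (asm) mult_left_cancel) auto
  qed
  moreover have "poly (map_poly of_int F) \<zeta> / of_int N = (\<Sum>j<?k. of_int (r j) * \<zeta> ^ j) / of_int M"
  proof -
    have "poly (map_poly of_int F) \<zeta> = poly (map_poly of_int R) \<zeta>"
      by (simp add: F map_poly_of_int_add map_poly_of_int_mult pisot_polynomial_root)
    also have "\<dots> = (\<Sum>j<?k. of_int (g * r j) * \<zeta> ^ j)"
      using R by (subst poly_eq_sum_lessThan[of ?k]) (simp_all add: r)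
    also have "\<dots> = of_int g * (\<Sum>j<?k. of_int (r j) * \<zeta> ^ j)"
      by (simp add: sum_distrib_left mult_ac)
    finally show ?thesis
      using g0 by (simp add: M)
  qed
  ultimately have "reduced_form P \<zeta> (poly (map_poly of_int F) \<zeta> / of_int N) r M"
    by (simp add: reduced_form_def)
  thus ?thesis
    by (intro that) (auto simp: has_denominator_def)
qed

text \<open>Writing P = c + x A gives 1/\<zeta> = A(\<zeta>)/(-c), so every inverse power is an
  integer polynomial in \<zeta> over an integer.\<close>

lemma has_denominator_inverse_power:
  assumes "\<zeta> \<noteq> 0"
  obtains M where "has_denominator P \<zeta> (1 / \<zeta> ^ n) M"
proof -
  define A where "A = poly_shift 1 P"
  define c where "c = poly P 0"
  have c: "c \<noteq> 0"
    using pisot_polynomial_at_0[OF assms] by (simp add: c_def)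
  have "P = pCons c A"
    by (intro poly_eqI) (auto simp: A_def c_def coeff_poly_shift coeff_pCons poly_0_coeff_0 split: nat.splits)
  hence "of_int c + \<zeta> * poly (map_poly of_int A) \<zeta> = 0"
    using pisot_polynomial_root by (simp add: map_poly_pCons)
  hence "1 / \<zeta> = poly (map_poly of_int A) \<zeta> / of_int (- c)"
    using assms c by (simp add: field_simps)
  hence "(1 / \<zeta>) ^ n = (poly (map_poly of_int A) \<zeta> / of_int (- c)) ^ n"
    by simp
  hence "1 / \<zeta> ^ n = poly (map_poly of_int (A ^ n)) \<zeta> / of_int ((- c) ^ n)"
    by (simp only: power_divide map_poly_of_int_power poly_power power_one of_int_power)
  moreover have "(- c) ^ n \<noteq> 0"
    using c by simp
  ultimately show ?thesis
    using has_denominator_exists that by metis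
qed

lemma prime_power_dvd_denominator:
  assumes q: "prime q" and P0: "q dvd poly P 0" and \<zeta>: "\<zeta> \<noteq> 0"
    and m: "\<And>i. i < m \<Longrightarrow> q dvd poly.coeff P i" "\<not> q dvd poly.coeff P m"
    and N: "has_denominator P \<zeta> (1 / \<zeta> ^ (l * m)) N"
  shows "q ^ l dvd N"
proof -
  \<comment> \<open>Dropping the m lowest coefficients, all multiples of q, leaves a constant term
    prime to q.\<close>
  define A where "A = poly_shift m P"
  have "[:q:] dvd poly_cutoff m P"
    using m(1) by (simp add: const_poly_dvd_iff coeff_poly_cutoff)
  then obtain B where B: "poly_cutoff m P = [:q:] * B"
    by (elim dvdE)
  have PAB: "P = Polynomial.monom 1 m * A + [:q:] * B"
    unfolding B[symmetric]
    by (intro poly_eqI) (auto simp: A_def coeff_poly_shift coeff_poly_cutoff coeff_monom_mult)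
  obtain r where "reduced_form P \<zeta> (1 / \<zeta> ^ (l * m)) r N"
    using N by (auto simp: has_denominator_def)
  hence N1: "N \<ge> 1" and r: "1 / \<zeta> ^ (l * m) = (\<Sum>j<Polynomial.degree P. of_int (r j) * \<zeta> ^ j) / of_int N"
    by (auto simp: reduced_form_def)
  define R where "R = (\<Sum>j<Polynomial.degree P. Polynomial.monom (r j) j)"
  let ?e = "\<lambda>p. poly (map_poly real_of_int p) \<zeta>"
  have e_simps: "?e (p + s) = ?e p + ?e s" "?e (p * s) = ?e p * ?e s" "?e (p ^ n) = ?e p ^ n"
    "?e [:c:] = of_int c" "?e (Polynomial.monom 1 n) = \<zeta> ^ n" for p s n c
    by (simp_all add: map_poly_of_int_add map_poly_of_int_mult map_poly_of_int_power
        map_poly_pCons map_poly_monom poly_monom)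
  have "?e R = (\<Sum>j<Polynomial.degree P. of_int (poly.coeff R j) * \<zeta> ^ j)"
    by (intro poly_eq_sum_lessThan) (simp add: R_def coeff_sum Polynomial.coeff_monom)
  also have "\<dots> = (\<Sum>j<Polynomial.degree P. of_int (r j) * \<zeta> ^ j)"
    by (simp add: R_def coeff_sum Polynomial.coeff_monom)
  finally have NR: "of_int N = (\<zeta> ^ m) ^ l * ?e R"
    using r N1 \<zeta> by (simp add: field_simps flip: power_mult)
  \<comment> \<open>This is the vanishing of \<open>P\<close> at \<zeta>, read through the splitting
    \<open>PAB\<close>; its l-th power supplies the factor \<open>q ^ l\<close>.\<close>
  have \<zeta>A: "\<zeta> ^ m * ?e A = - of_int q * ?e B"
    using pisot_polynomial_root by (subst (asm) PAB) (simp only: e_simps mult_minus_left eq_neg_iff_add_eq_0)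
  have "?e ([:N:] * A ^ l) = (\<zeta> ^ m * ?e A) ^ l * ?e R"
    by (simp only: e_simps NR power_mult_distrib mult_ac)
  also have "\<dots> = ?e ([:q ^ l:] * ([:(- 1) ^ l:] * B ^ l * R))"
    unfolding \<zeta>A e_simps by (simp add: power_mult_distrib power_minus[of "_ * _"])
  \<comment> \<open>The difference is written with the constant polynomial -1, as
    \<open>e_simps\<close> evaluates sums and products but not subtraction.\<close>
  finally have "?e ([:N:] * A ^ l + [:- 1:] * ([:q ^ l:] * ([:(- 1) ^ l:] * B ^ l * R))) = 0"
    by (simp add: e_simps del: mult_pCons_left mult_pCons_right)
  from pisot_polynomial_dvd[OF this]
  obtain S where "[:N:] * A ^ l + [:- 1:] * ([:q ^ l:] * ([:(- 1) ^ l:] * B ^ l * R)) = P * S"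
    by (elim dvdE)
  moreover have "[:- 1:] * T = - T" for T :: "int poly"
    by simp
  ultimately have "[:N:] * A ^ l = [:q ^ l:] * ([:(- 1) ^ l:] * B ^ l * R) + P * S"
    by (metis add.commute add_uminus_conv_diff diff_eq_eq)
  moreover have "\<not> q dvd poly A 0"
    using m(2) by (simp add: A_def poly_0_coeff_0 coeff_poly_shift)
  ultimately show ?thesis
    using prime_power_dvd_of_poly_identity[OF q pisot_polynomial_monic P0] by blast
qed

end

text \<open>The numerator is kept: a common divisor of \<open>N\<close> and the coefficients also
  divides \<open>N * M\<close>, so it is trivial.\<close>

lemma has_denominator_cofactor_mult:
  assumes "has_denominator P \<zeta> a (N * M)" "N \<ge> 1"
  shows "has_denominator P \<zeta> (of_int M * a) N"
proof -
  let ?k = "Polynomial.degree P"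
  obtain r where r: "N * M \<ge> 1" "Gcd (insert (N * M) (r ` {..<?k})) = 1"
    "a = (\<Sum>j<?k. of_int (r j) * \<zeta> ^ j) / of_int (N * M)"
    using assms(1) unfolding has_denominator_def reduced_form_def by blast
  have "Gcd (insert N (r ` {..<?k})) dvd Gcd (insert (N * M) (r ` {..<?k}))"
    by (intro Gcd_greatest) (auto simp del: Gcd_insert intro: dvd_mult2 Gcd_dvd)
  hence "Gcd (insert N (r ` {..<?k})) = 1"
    using r(2) by (simp del: Gcd_insert)
  moreover have "M \<noteq> 0"
    using r(1) by auto
  hence "of_int M * a = (\<Sum>j<?k. of_int (r j) * \<zeta> ^ j) / of_int N"
    unfolding r(3) by simp
  ultimately show ?thesis
    using assms(2) unfolding has_denominator_def reduced_form_def by blast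
qed

section \<open>Integral power sums and the powers of a Pisot number\<close>

text \<open>Newton's identities as one power series identity, the logarithmic derivative of \<open>D\<close>;
  the right-hand factor omits the constant term \<open>size Z\<close>.\<close>

lemma fps_logderiv_prod_linear:
  fixes Z :: "'a :: field_char_0 multiset"
  defines "D \<equiv> (\<Prod>z\<in>#Z. 1 - fps_const z * fps_X)"
  shows "- fps_X * fps_deriv D = D * Abs_fps (\<lambda>n. if n = 0 then 0 else \<Sum>z\<in>#Z. z ^ n)"
  unfolding D_def
proof (induction Z)
  case empty
  show ?case
    by (simp add: fps_eq_iff)
next
  case (add z Z)
  define D where "D = (\<Prod>z\<in>#Z. 1 - fps_const z * fps_X)"
  define S where "S = Abs_fps (\<lambda>n. if n = 0 then 0 else \<Sum>z\<in>#Z. z ^ n)"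
  define T where "T = Abs_fps (\<lambda>n. if n = 0 then 0 else z ^ n)"
  define L where "L = 1 - fps_const z * fps_X"
  \<comment> \<open>\<open>T\<close> is the geometric series of z x without its constant term; the
    product rule then adds it to \<open>S\<close>.\<close>
  have "L * T = fps_const z * fps_X"
    by (rule fps_ext) (auto simp: L_def T_def left_diff_distrib mult.assoc fps_X_mult_nth
        le_Suc_eq simp flip: power_Suc)
  moreover have "fps_deriv L = - fps_const z"
    by (simp add: L_def)
  ultimately have "- fps_X * fps_deriv (L * D) = L * D * (T + S)"
    using add.IH unfolding D_def[symmetric] S_def[symmetric]
    by (simp add: algebra_simps del: fps_const_neg)
  moreover have "T + S = Abs_fps (\<lambda>n. if n = 0 then 0 else \<Sum>z\<in>#add_mset z Z. z ^ n)"
    by (rule fps_ext) (simp add: T_def S_def)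
  ultimately show ?case
    by (simp add: D_def L_def)
qed

text \<open>Comparing coefficients in the logarithmic derivative identity gives a recursion. The
  constant term of \<open>D\<close> is 1, so the n-th power sum is isolated without any
  division.\<close>

lemma power_sum_in_Ints:
  fixes Z :: "'a :: field_char_0 multiset"
  assumes "\<And>n. fps_nth (\<Prod>z\<in>#Z. 1 - fps_const z * fps_X) n \<in> \<int>"
  shows "(\<Sum>z\<in>#Z. z ^ n) \<in> \<int>"
proof (induction n rule: less_induct)
  case (less n)
  define D where "D = (\<Prod>z\<in>#Z. 1 - fps_const z * fps_X)"
  define S where "S = Abs_fps (\<lambda>n. if n = 0 then 0 else \<Sum>z\<in>#Z. z ^ n)"
  show ?case
  proof (cases "n = 0")
    case False
    have D0: "fps_nth D 0 = 1"
      unfolding D_def by (induction Z) auto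
    have "fps_nth (- fps_X * fps_deriv D) n = fps_nth (D * S) n"
      using fps_logderiv_prod_linear[of Z] by (simp add: D_def S_def)
    hence "- (of_nat n * fps_nth D n) = (\<Sum>i=0..n. fps_nth D i * fps_nth S (n - i))"
      using False by (simp add: fps_mult_nth[of D])
    also have "\<dots> = fps_nth S n + (\<Sum>i=Suc 0..n. fps_nth D i * fps_nth S (n - i))"
      by (subst sum.atLeast_Suc_atMost) (simp_all add: D0)
    finally have eq: "(\<Sum>z\<in>#Z. z ^ n) =
        - (of_nat n * fps_nth D n) - (\<Sum>i=Suc 0..n. fps_nth D i * fps_nth S (n - i))"
      using False by (simp add: S_def algebra_simps)
    \<comment> \<open>For i = n the second factor is the constant term of \<open>S\<close>, which is
      0 by convention; smaller i use the induction hypothesis.\<close>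
    have *: "fps_nth D i * fps_nth S (n - i) \<in> \<int>" if "i \<in> {Suc 0..n}" for i
      using assms less.IH[of "n - i"] that by (auto simp: D_def S_def)
    have "- (of_nat n * fps_nth D n) - (\<Sum>i=Suc 0..n. fps_nth D i * fps_nth S (n - i)) \<in> \<int>"
      using assms by (intro Ints_diff Ints_minus Ints_mult[of "of_nat n"] Ints_sum *) (auto simp: D_def)
    thus ?thesis
      by (simp only: eq)
  qed simp
qed

text \<open>The product of the factors 1 - z x over the roots is the reversal of the monic
  \<open>P\<close>, hence has integer coefficients.\<close>

lemma power_sum_proots_in_Ints:
  fixes P :: "int poly"
  assumes "Polynomial.lead_coeff P = 1"
  shows "(\<Sum>z\<in>#proots (map_poly of_int P :: complex poly). z ^ n) \<in> \<int>"
proof (rule power_sum_in_Ints)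
  fix i
  let ?p = "map_poly of_int P :: complex poly"
  have lc: "Polynomial.lead_coeff ?p = 1"
    using assms by (subst lead_coeff_map_poly_nz) auto
  have lin: "fps_of_poly (reflect_poly [:- z, 1:]) = 1 - fps_const z * fps_X" for z :: complex
    by (simp add: reflect_poly_def cCons_def fps_of_poly_pCons)
  have "(\<Prod>z\<in>#Z. 1 - fps_const z * fps_X) =
      fps_of_poly (reflect_poly (\<Prod>z\<in>#Z. [:-z, 1:]))" for Z :: "complex multiset"
    by (induction Z) (simp_all add: reflect_poly_mult fps_of_poly_mult lin
        del: mult_pCons_left mult_pCons_right)
  also have "(\<Prod>z\<in>#proots ?p. [:-z, 1:]) = ?p"
    using complex_poly_decompose_multiset[of ?p] by (simp add: lc)
  finally show "fps_nth (\<Prod>z\<in>#proots ?p. 1 - fps_const z * fps_X) i \<in> \<int>"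
    by (simp add: coeff_reflect_poly coeff_map_poly)
qed

text \<open>Simplicity of the root \<zeta> matters: after removing one copy, every remaining root is
  a conjugate different from \<zeta>.\<close>

lemma pisot_number_proots:
  assumes \<zeta>: "pisot_number \<zeta>" and P: "is_pisot_polynomial \<zeta> P"
  obtains Z where "proots (map_poly of_int P) = add_mset (complex_of_real \<zeta>) Z"
    "\<And>z. z \<in># Z \<Longrightarrow> cmod z < 1"
proof -
  let ?p = "map_poly of_int P :: complex poly" and ?z = "complex_of_real \<zeta>"
  have p0: "?p \<noteq> 0"
    using pisot_polynomial_monic[OF P] by (subst map_poly_eq_0_iff) auto
  have root: "poly ?p ?z = 0"
    by (simp add: poly_of_int_of_real pisot_polynomial_root[OF P])
  have simple: "Polynomial.order ?z ?p \<le> 1"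
  proof (rule ccontr)
    assume "\<not> ?thesis"
    \<comment> \<open>A double root would be a root of the derivative, and \<open>P\<close> would
      divide a nonzero polynomial of smaller degree.\<close>
    hence "[:- ?z, 1:] ^ 2 dvd ?p"
      by (intro dvd_trans[OF le_imp_power_dvd order_1]) simp
    then obtain r where "?p = [:- ?z, 1:] ^ 2 * r"
      by (elim dvdE)
    hence "poly (pderiv ?p) ?z = 0"
      by (simp add: pderiv_mult power2_eq_square del: mult_pCons_left mult_pCons_right)
    hence "poly (map_poly of_int (pderiv P)) \<zeta> = 0"
      by (simp add: map_poly_of_int_pderiv[symmetric] poly_of_int_of_real)
    hence "P dvd pderiv P"
      by (rule pisot_polynomial_dvd[OF P])
    thus False
      using pisot_polynomial_degree_pos[OF P] by simp
  qed
  define Z where "Z = proots ?p - {#?z#}"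
  have "?z \<in># proots ?p"
    using p0 root by simp
  hence "proots ?p = add_mset ?z Z"
    by (simp add: Z_def)
  moreover have "cmod z < 1" if "z \<in># Z" for z
  proof -
    have "count Z ?z = 0"
      using simple p0 by (simp add: Z_def)
    with that have "z \<noteq> ?z"
      by (metis not_in_iff)
    moreover have "z \<in># proots ?p"
      using that by (auto simp: Z_def dest: in_diffD)
    hence "poly ?p z = 0"
      using p0 by simp
    hence "z \<in> conjugates \<zeta>"
      using P unfolding conjugates_def is_pisot_polynomial_def
      by (auto simp: map_poly_map_poly o_def intro!: exI[of _ "map_poly rat_of_int P"])
    ultimately show ?thesis
      using \<zeta> by (auto simp: pisot_number_def)
  qed
  ultimately show ?thesis
    by (rule that)
qed

lemma tendsto_sum_mset_power_zero:
  fixes Z :: "complex multiset"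
  assumes "\<And>z. z \<in># Z \<Longrightarrow> cmod z < 1"
  shows "(\<lambda>n. \<Sum>z\<in>#Z. z ^ n) \<longlonglongrightarrow> 0"
  using assms
proof (induction Z)
  case (add z Z)
  hence "(\<lambda>n. z ^ n + (\<Sum>z\<in>#Z. z ^ n)) \<longlonglongrightarrow> 0 + 0"
    by (intro tendsto_add LIMSEQ_power_zero) auto
  thus ?case by simp
qed simp

lemma pisot_number_power_near_int:
  assumes \<zeta>: "pisot_number \<zeta>" and P: "is_pisot_polynomial \<zeta> P"
  obtains t :: "nat \<Rightarrow> int" where "(\<lambda>n. \<zeta> ^ n - of_int (t n)) \<longlonglongrightarrow> 0"
proof -
  obtain Z where Z: "proots (map_poly of_int P) = add_mset (complex_of_real \<zeta>) Z"
    "\<And>z. z \<in># Z \<Longrightarrow> cmod z < 1"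
    using pisot_number_proots[OF assms] by blast
  have "\<exists>t::int. complex_of_real \<zeta> ^ n + (\<Sum>z\<in>#Z. z ^ n) = of_int t" for n
    using power_sum_proots_in_Ints[OF pisot_polynomial_monic[OF P], of n]
    by (auto simp: Z(1) elim: Ints_cases)
  then obtain t :: "nat \<Rightarrow> int" where t: "\<And>n. complex_of_real \<zeta> ^ n + (\<Sum>z\<in>#Z. z ^ n) = of_int (t n)"
    by metis
  have "(\<lambda>n. - (\<Sum>z\<in>#Z. z ^ n)) \<longlonglongrightarrow> - 0"
    by (intro tendsto_minus tendsto_sum_mset_power_zero Z(2))
  \<comment> \<open>The full power sum is the integer \<open>t n\<close>, so the sum over the other
    roots is exactly the real error; the limit can be taken back to the reals.\<close>
  also have "(\<lambda>n. - (\<Sum>z\<in>#Z. z ^ n)) = (\<lambda>n. complex_of_real (\<zeta> ^ n - of_int (t n)))"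
    by (simp flip: t)
  finally have "(\<lambda>n. \<zeta> ^ n - of_int (t n)) \<longlonglongrightarrow> 0"
    using tendsto_of_real_iff[of "\<lambda>n. \<zeta> ^ n - of_int (t n)" 0 sequentially, where 'a = complex] by simp
  thus ?thesis
    by (rule that)
qed

section \<open>Closure properties of \<open>scriptM\<close>\<close>

text \<open>Rounding is not additive, but arbitrary integer approximations can be added and scaled.
  They suffice because the rounded value is at least as close.\<close>

lemma scriptM_iff_near_int:
  "\<alpha> \<in> scriptM \<zeta> \<longleftrightarrow> (\<exists>t :: nat \<Rightarrow> int. (\<lambda>n. \<alpha> * \<zeta> ^ n - of_int (t n)) \<longlonglongrightarrow> 0)"
proof
  assume "\<alpha> \<in> scriptM \<zeta>"
  hence "(\<lambda>n. \<alpha> * \<zeta> ^ n - of_int (round (\<alpha> * \<zeta> ^ n))) \<longlonglongrightarrow> 0"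
    by (simp add: scriptM_def dist_nearest_int_def tendsto_rabs_zero_iff)
  thus "\<exists>t :: nat \<Rightarrow> int. (\<lambda>n. \<alpha> * \<zeta> ^ n - of_int (t n)) \<longlonglongrightarrow> 0"
    by (intro exI[of _ "\<lambda>n. round (\<alpha> * \<zeta> ^ n)"])
next
  assume "\<exists>t :: nat \<Rightarrow> int. (\<lambda>n. \<alpha> * \<zeta> ^ n - of_int (t n)) \<longlonglongrightarrow> 0"
  then obtain t :: "nat \<Rightarrow> int" where "(\<lambda>n. \<alpha> * \<zeta> ^ n - of_int (t n)) \<longlonglongrightarrow> 0"
    by blast
  hence "(\<lambda>n. dist_nearest_int (\<alpha> * \<zeta> ^ n)) \<longlonglongrightarrow> 0"
    by (rule tendsto_0_le[where K = 1])
      (auto simp: dist_nearest_int_def intro!: always_eventually round_diff_minimal)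
  thus "\<alpha> \<in> scriptM \<zeta>"
    by (simp add: scriptM_def)
qed

lemma scriptM_zero: "0 \<in> scriptM \<zeta>"
  unfolding scriptM_iff_near_int by (auto intro!: exI[of _ "\<lambda>_. 0"])

lemma scriptM_add:
  assumes "\<alpha> \<in> scriptM \<zeta>" "\<beta> \<in> scriptM \<zeta>"
  shows "\<alpha> + \<beta> \<in> scriptM \<zeta>"
proof -
  obtain t u :: "nat \<Rightarrow> int" where "(\<lambda>n. \<alpha> * \<zeta> ^ n - of_int (t n)) \<longlonglongrightarrow> 0"
    "(\<lambda>n. \<beta> * \<zeta> ^ n - of_int (u n)) \<longlonglongrightarrow> 0"
    using assms unfolding scriptM_iff_near_int by blast
  hence "(\<lambda>n. (\<alpha> * \<zeta> ^ n - of_int (t n)) + (\<beta> * \<zeta> ^ n - of_int (u n))) \<longlonglongrightarrow> 0 + 0"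
    by (rule tendsto_add)
  thus ?thesis
    unfolding scriptM_iff_near_int
    by (intro exI[of _ "\<lambda>n. t n + u n"]) (simp add: algebra_simps)
qed

lemma scriptM_int_mult:
  assumes "\<alpha> \<in> scriptM \<zeta>"
  shows "of_int c * \<alpha> \<in> scriptM \<zeta>"
proof -
  obtain t :: "nat \<Rightarrow> int" where "(\<lambda>n. \<alpha> * \<zeta> ^ n - of_int (t n)) \<longlonglongrightarrow> 0"
    using assms unfolding scriptM_iff_near_int by blast
  hence "(\<lambda>n. of_int c * (\<alpha> * \<zeta> ^ n - of_int (t n))) \<longlonglongrightarrow> of_int c * 0"
    by (intro tendsto_mult_left)
  thus ?thesis
    unfolding scriptM_iff_near_int
    by (intro exI[of _ "\<lambda>n. c * t n"]) (simp add: algebra_simps)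
qed

text \<open>Multiplying by a power of \<zeta> only shifts the index of the sequence for 1.\<close>

lemma scriptM_powi:
  assumes "1 \<in> scriptM \<zeta>" "\<zeta> \<noteq> 0"
  shows "\<zeta> powi i \<in> scriptM \<zeta>"
proof -
  have "(\<lambda>n. dist_nearest_int (\<zeta> ^ n)) \<longlonglongrightarrow> 0"
    using assms(1) by (simp add: scriptM_def)
  moreover have "filterlim (\<lambda>n. nat (int n + i)) at_top sequentially"
    unfolding filterlim_at_top
  proof
    fix N
    show "\<forall>\<^sub>F n in sequentially. N \<le> nat (int n + i)"
      by (rule eventually_sequentiallyI[of "N + nat \<bar>i\<bar>"]) linarith
  qed
  ultimately have lim: "(\<lambda>n. dist_nearest_int (\<zeta> ^ nat (int n + i))) \<longlonglongrightarrow> 0"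
    by (rule filterlim_compose)
  \<comment> \<open>The bound on n keeps \<open>nat\<close> from truncating a negative exponent to
    0.\<close>
  have "\<zeta> ^ nat (int n + i) = \<zeta> powi i * \<zeta> ^ n" if "n \<ge> nat \<bar>i\<bar>" for n
  proof -
    have "\<zeta> ^ nat (int n + i) = \<zeta> powi (i + int n)"
      using that by (subst power_int_nonneg_exp) (auto simp: add.commute)
    thus ?thesis
      using assms(2) by (simp add: power_int_add)
  qed
  hence "\<forall>\<^sub>F n in sequentially. dist_nearest_int (\<zeta> ^ nat (int n + i)) = dist_nearest_int (\<zeta> powi i * \<zeta> ^ n)"
    by (intro eventually_sequentiallyI[of "nat \<bar>i\<bar>"]) simp
  from Lim_transform_eventually[OF lim this] show ?thesis
    by (simp add: scriptM_def)
qed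

lemma int_laurent_ring_subset_scriptM:
  assumes \<zeta>: "pisot_number \<zeta>" and P: "is_pisot_polynomial \<zeta> P"
  shows "int_laurent_ring \<zeta> \<subseteq> scriptM \<zeta>"
proof -
  obtain t :: "nat \<Rightarrow> int" where "(\<lambda>n. \<zeta> ^ n - of_int (t n)) \<longlonglongrightarrow> 0"
    using pisot_number_power_near_int[OF assms] by blast
  hence "1 \<in> scriptM \<zeta>"
    unfolding scriptM_iff_near_int by auto
  moreover have "\<zeta> \<noteq> 0"
    using \<zeta> by (auto simp: pisot_number_def)
  ultimately have powi: "\<zeta> powi i \<in> scriptM \<zeta>" for i
    by (rule scriptM_powi)
  have "(\<Sum>i\<in>I. of_int (c i) * \<zeta> powi i) \<in> scriptM \<zeta>" if "finite I" for I and c :: "int \<Rightarrow> int"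
    using that by induction (auto intro: scriptM_zero scriptM_add scriptM_int_mult powi)
  thus ?thesis
    by (auto simp: int_laurent_ring_def)
qed

lemma int_mult_powi_in_int_laurent_ring: "of_int c * \<zeta> powi i \<in> int_laurent_ring \<zeta>"
  unfolding int_laurent_ring_def
  by (rule CollectI, rule exI[of _ "{i}"], rule exI[of _ "\<lambda>_. c"]) simp

theorem theorem3p15:
  fixes \<zeta> :: real and P :: "int poly" and q :: int and m :: nat
  assumes "pisot_number \<zeta>"
    and "is_pisot_polynomial \<zeta> P"
    and "prime q"
    and "q dvd poly P 0"
    and "m = zero_multiplicity_mod q P"
  shows "m \<ge> 1
    \<and> (\<forall>l::nat. l \<ge> 1 \<longrightarrow> \<zeta> powi (- int (l * m)) \<in> int_laurent_ring \<zeta> \<and>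
         (\<exists>N. has_denominator P \<zeta> (\<zeta> powi (- int (l * m))) N \<and> q ^ l dvd N))
    \<and> int_laurent_ring \<zeta> \<subseteq> scriptM \<zeta>
    \<and> (\<forall>l::nat. l \<ge> 1 \<longrightarrow> (\<exists>a \<in> int_laurent_ring \<zeta>. has_denominator P \<zeta> a (q ^ l)))"
proof -
  note P = assms(2)
  have \<zeta>: "\<zeta> \<noteq> 0"
    using assms(1) by (auto simp: pisot_number_def)
  note m = zero_multiplicity_mod_least_coeff[OF assms(3) pisot_polynomial_monic[OF P], folded assms(5)]
  \<comment> \<open>P(0) is the coefficient of degree 0 and divisible by q, whereas the coefficient
    of degree m is not.\<close>
  have "m \<noteq> 0"
    using m(2) assms(4) by (metis poly_0_coeff_0)
  hence "m \<ge> 1"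
    by simp
  moreover have powi: "\<zeta> powi (- int n) = 1 / \<zeta> ^ n" for n
    by (simp add: power_int_minus field_simps)
  have denom: "\<exists>N. has_denominator P \<zeta> (\<zeta> powi (- int (l * m))) N \<and> q ^ l dvd N" for l
    unfolding powi
    using has_denominator_inverse_power[OF P \<zeta>, of "l * m"]
      prime_power_dvd_denominator[OF P assms(3,4) \<zeta> m] by metis
  moreover have "\<zeta> powi (- int (l * m)) \<in> int_laurent_ring \<zeta>" for l
    using int_mult_powi_in_int_laurent_ring[of 1] by simp
  moreover have "int_laurent_ring \<zeta> \<subseteq> scriptM \<zeta>"
    by (rule int_laurent_ring_subset_scriptM[OF assms(1) P])
  moreover have "\<exists>a \<in> int_laurent_ring \<zeta>. has_denominator P \<zeta> a (q ^ l)" for l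
  proof -
    obtain M where "has_denominator P \<zeta> (\<zeta> powi (- int (l * m))) (q ^ l * M)"
      using denom[of l] by (auto elim: dvdE)
    moreover have "q ^ l \<ge> 1"
      using prime_gt_0_int[OF assms(3)] by simp
    \<comment> \<open>The integer factor \<open>M\<close> removes the surplus of the denominator and
      keeps the element in the Laurent ring.\<close>
    ultimately have "has_denominator P \<zeta> (of_int M * \<zeta> powi (- int (l * m))) (q ^ l)"
      by (rule has_denominator_cofactor_mult)
    thus ?thesis
      using int_mult_powi_in_int_laurent_ring by blast
  qed
  ultimately show ?thesis
    by blast
qed

end
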